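(* For any $0<\alpha,\beta<1$ and any positive integer $p$, there are positive integers $k,\ell$ such that $\mathrm{Z}_{\alpha,\beta}(G(\ell,k)-vx)-\mathrm{Z}_{\alpha,\beta}(G(\ell,k))\ge p$.
   Context: All graphs are finite and simple. $G-e$ denotes the graph obtained from $G$ by deleting the edge $e$. For positive integers $\ell,k$, $G(\ell,k)$ is the graph obtained by identifying a degree-1 vertex of the path $P_{k+1}$ on $k+1$ vertices with the central vertex of the star $K_{1,\ell}$; the identified vertex is called $v$ and its neighbor on the path is called $x$. Let $\alpha,\beta$ be the transmission proportion and the transmission threshold, let $G$ be a graph and $B\subseteq V(G)$ a set of initially filled vertices. The transmission forcing process started from $B$ is defined as follows. Put $B_0=B$, $w_0(v)=1$ for $v\in B$ and $w_0(v)=0$ for $v\in V(G)\setminus B$. For $t\ge 1$, given the set $B_{t-1}$ of vertices filled at time $t-1$ and the weights $w_{t-1}$: for each unfilled vertex $u\in V(G)\setminus B_{t-1}$ let $\mathcal V_{t,u}$ be the set of all $v\in B_{t-1}$ such that $u$ is the only neighbor of $v$ in $V(G)\setminus B_{t-1}$ and $v\notin \mathcal V_{s,u'}$ for every $s<t$ and every $u'$ (each vertex transmits weight at most once); when $v\in\mathcal V_{t,u}$ we say $v$ forces $u$, written $v\to u$. Set $w_t(u)=w_{t-1}(u)+\sum_{v\in\mathcal V_{t,u}}\alpha\, w_{t-1}(v)$ for $u\in V(G)\setminus B_{t-1}$ and $w_t(u)=w_{t-1}(u)$ for $u\in B_{t-1}$. Then $B_t=B_{t-1}\cup\{u\in V(G)\setminus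 B_{t-1} : w_t(u)\ge\beta\}$. The set $B$ is an $(\alpha,\beta)$-transmission zero forcing set of $G$ if $B_t=V(G)$ for some $t\ge 0$, and the $(\alpha,\beta)$-transmission zero forcing number $\mathrm{Z}_{\alpha,\beta}(G)$ is the minimum cardinality of such a set. *)

theory Defs
  imports Complex_Main "Graph_Theory.Pair_Digraph"
begin

text \<open>
  Finite simple graphs are modelled by the locale \<open>pair_graph\<close>: finite, loop-free, symmetric,
  without parallel arcs.  An undirected edge \<open>uv\<close> is the pair of arcs \<open>(u, v)\<close>, \<open>(v, u)\<close>.
\<close>

definition nbrs :: "'a pair_pre_digraph \<Rightarrow> 'a \<Rightarrow> 'a set" where
  "nbrs G v = {u. v \<rightarrow>\<^bsub>with_proj G\<^esub> u}"

definition delete_edge :: "'a pair_pre_digraph \<Rightarrow> 'a \<Rightarrow> 'a \<Rightarrow> 'a pair_pre_digraph" where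
  "delete_edge G u v = G\<lparr> parcs := parcs G - {(u, v), (v, u)} \<rparr>"

lemma pair_graph_delete_edge:
  assumes "pair_graph G"
  shows "pair_graph (delete_edge G u v)"
proof -
  interpret pair_graph G by (fact assms)
  have "sym (parcs G)"
    using pair_sym_arcs by (simp add: symmetric_def)
  then have "sym (parcs G - {(u, v), (v, u)})"
    by (auto simp: sym_def)
  then show ?thesis
    by unfold_locales
      (auto simp: delete_edge_def symmetric_def pair_finite_verts pair_finite_arcs
        dest: wellformed' pair_no_loops)
qed


text \<open>
  The process at time \<open>t\<close>: \<open>filled\<close> is $B_t$, \<open>weight\<close> is $w_t$, and \<open>spent\<close> collects the vertices
  that have transmitted at some time $s \le t$ (see \<open>spent_eq_Union_forcers\<close> below).
\<close>

record 'a tstate =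
  filled :: "'a set"
  weight :: "'a \<Rightarrow> real"
  spent :: "'a set"

definition unfilled :: "'a pair_pre_digraph \<Rightarrow> 'a tstate \<Rightarrow> 'a set" where
  "unfilled G S = pverts G - filled S"

text \<open>\<open>forcers G S u\<close> is $\mathcal V_{t,u}$ where \<open>S\<close> is the state at time $t - 1$.\<close>

definition forcers :: "'a pair_pre_digraph \<Rightarrow> 'a tstate \<Rightarrow> 'a \<Rightarrow> 'a set" where
  "forcers G S u = {v \<in> filled S. nbrs G v \<inter> unfilled G S = {u} \<and> v \<notin> spent S}"

definition new_weight :: "'a pair_pre_digraph \<Rightarrow> real \<Rightarrow> 'a tstate \<Rightarrow> 'a \<Rightarrow> real" where
  "new_weight G \<alpha> S u =
     (if u \<in> unfilled G S then weight S u + (\<Sum>v\<in>forcers G S u. \<alpha> * weight S v)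
      else weight S u)"

definition tstep :: "'a pair_pre_digraph \<Rightarrow> real \<Rightarrow> real \<Rightarrow> 'a tstate \<Rightarrow> 'a tstate" where
  "tstep G \<alpha> \<beta> S =
     \<lparr> filled = filled S \<union> {u \<in> unfilled G S. new_weight G \<alpha> S u \<ge> \<beta>},
       weight = new_weight G \<alpha> S,
       spent = spent S \<union> (\<Union>u\<in>unfilled G S. forcers G S u) \<rparr>"

definition tinit :: "'a set \<Rightarrow> 'a tstate" where
  "tinit B = \<lparr> filled = B, weight = (\<lambda>v. if v \<in> B then 1 else 0), spent = {} \<rparr>"

primrec tstate_at :: "'a pair_pre_digraph \<Rightarrow> real \<Rightarrow> real \<Rightarrow> 'a set \<Rightarrow> nat \<Rightarrow> 'a tstate" where
  "tstate_at G \<alpha> \<beta> B 0 = tinit B"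
| "tstate_at G \<alpha> \<beta> B (Suc t) = tstep G \<alpha> \<beta> (tstate_at G \<alpha> \<beta> B t)"

lemma spent_eq_Union_forcers:
  "spent (tstate_at G \<alpha> \<beta> B t) =
     (\<Union>s<t. \<Union>u\<in>unfilled G (tstate_at G \<alpha> \<beta> B s). forcers G (tstate_at G \<alpha> \<beta> B s) u)"
  by (induction t) (auto simp: tinit_def tstep_def lessThan_Suc)

definition transmission_zf_set :: "'a pair_pre_digraph \<Rightarrow> real \<Rightarrow> real \<Rightarrow> 'a set \<Rightarrow> bool" where
  "transmission_zf_set G \<alpha> \<beta> B \<longleftrightarrow>
     B \<subseteq> pverts G \<and> (\<exists>t. filled (tstate_at G \<alpha> \<beta> B t) = pverts G)"

definition transmission_zf_number :: "'a pair_pre_digraph \<Rightarrow> real \<Rightarrow> real \<Rightarrow> nat" where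
  "transmission_zf_number G \<alpha> \<beta> = Min (card ` {B. transmission_zf_set G \<alpha> \<beta> B})"

text \<open>The minimum is taken over a finite nonempty set:\<close>

lemma transmission_zf_set_pverts: "transmission_zf_set G \<alpha> \<beta> (pverts G)"
  unfolding transmission_zf_set_def by (auto intro: exI[of _ 0] simp: tinit_def)

lemma finite_transmission_zf_sets:
  assumes "pair_graph G"
  shows "finite {B. transmission_zf_set G \<alpha> \<beta> B}"
proof -
  interpret pair_graph G by (fact assms)
  show ?thesis
    by (rule finite_subset[of _ "Pow (pverts G)"])
      (auto simp: transmission_zf_set_def pair_finite_verts)
qed


text \<open>
  The path and the star are realised on a common vertex type in such a way that they share exactly
  the vertex \<open>PathV 0\<close>, an end of the path and the centre of the star.  Identifying the two
  vertices then amounts to taking the union of the graphs.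
\<close>

datatype gvert = PathV nat | Leaf nat

text \<open>The path $P_{k+1}$ on $k + 1$ vertices:\<close>

definition path_graph :: "nat \<Rightarrow> gvert pair_pre_digraph" where
  "path_graph k =
     \<lparr> pverts = PathV ` {..k},
       parcs = (\<Union>i<k. {(PathV i, PathV (Suc i)), (PathV (Suc i), PathV i)}) \<rparr>"

text \<open>The star $K_{1,\ell}$:\<close>

definition star_graph :: "nat \<Rightarrow> gvert pair_pre_digraph" where
  "star_graph l =
     \<lparr> pverts = insert (PathV 0) (Leaf ` {..<l}),
       parcs = (\<Union>j<l. {(PathV 0, Leaf j), (Leaf j, PathV 0)}) \<rparr>"

text \<open>The graph $G(\ell, k)$ with its vertices $v$ and $x$:\<close>

definition G_graph :: "nat \<Rightarrow> nat \<Rightarrow> gvert pair_pre_digraph" where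
  "G_graph l k =
     \<lparr> pverts = pverts (star_graph l) \<union> pverts (path_graph k),
       parcs = parcs (star_graph l) \<union> parcs (path_graph k) \<rparr>"

definition v_vertex :: gvert where "v_vertex = PathV 0"

definition x_vertex :: gvert where "x_vertex = PathV 1"

lemma star_Int_path: "pverts (star_graph l) \<inter> pverts (path_graph k) = {v_vertex}"
  by (auto simp: star_graph_def path_graph_def v_vertex_def)

lemma nbr_v_on_path: "k > 0 \<Longrightarrow> nbrs (path_graph k) v_vertex = {x_vertex}"
  by (auto simp: nbrs_def path_graph_def v_vertex_def x_vertex_def)

lemma pair_graph_G_graph: "pair_graph (G_graph l k)"
  by unfold_locales
    (auto simp: G_graph_def star_graph_def path_graph_def symmetric_def sym_def)

end

theory Submission
  imports Defs
begin

text \<open>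
  Let all \<open>l\<close> leaves be filled.  In \<open>G(l, k)\<close> they give \<open>v\<close> the weight \<open>l \<alpha>\<close>, which then travels
  along the whole path as soon as \<open>l \<alpha>\<^sup>k\<^sup>+\<^sup>1 \<ge> \<beta>\<close>; so \<open>l\<close> filled vertices suffice.  Without the edge
  \<open>vx\<close> at least \<open>l - 1\<close> leaves must still be filled, because \<open>v\<close> forces at most one of them, and the
  path gets no help from the star.  On the path the weight decays by the factor \<open>\<alpha>\<close> per step, so
  that each of its segments of a length depending on \<open>\<alpha>\<close> and \<open>\<beta>\<close> only contains an initially
  filled vertex.  A path of \<open>p + 1\<close> such segments costs \<open>p + 1\<close> vertices.
\<close>

section \<open>The transmission process on an arbitrary graph\<close>

lemma mem_nbrs_iff: "u \<in> nbrs G v \<longleftrightarrow> (v, u) \<in> parcs G"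
  by (auto simp: nbrs_def)

lemma spent_subset_filled: "spent (tstate_at G \<alpha> \<beta> B t) \<subseteq> filled (tstate_at G \<alpha> \<beta> B t)"
  by (induction t) (auto simp: tinit_def tstep_def forcers_def)

lemma initial_subset_filled: "B \<subseteq> filled (tstate_at G \<alpha> \<beta> B t)"
  by (induction t) (auto simp: tinit_def tstep_def)

lemma filled_imp_weight_ge:
  "u \<in> filled (tstate_at G \<alpha> \<beta> B t) \<Longrightarrow> u \<notin> B \<Longrightarrow> weight (tstate_at G \<alpha> \<beta> B t) u \<ge> \<beta>"
  by (induction t) (auto simp: tinit_def tstep_def unfilled_def new_weight_def)

text \<open>
  The instance to think of is \<open>h u = \<alpha> ^ dist u B\<close>.  The factor \<open>card (nbrs G u \<inter> spent _)\<close>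
  makes the induction work: a vertex about to force has a neighbour that is not spent, hence at most
  one spent neighbour, so it passes on at most \<open>\<alpha> * h\<close>.
\<close>

lemma weight_le_card_spent:
  fixes h :: "'a \<Rightarrow> real"
  assumes closed: "\<And>u v. u \<in> C \<Longrightarrow> u \<in> nbrs G v \<Longrightarrow> v \<in> C \<and> v \<in> nbrs G u"
    and fin: "\<And>u. u \<in> C \<Longrightarrow> finite (nbrs G u)"
    and deg: "\<And>u. u \<in> C \<Longrightarrow> card (nbrs G u) \<le> 2"
    and h_nonneg: "\<And>u. u \<in> C \<Longrightarrow> 0 \<le> h u"
    and h_init: "\<And>u. u \<in> C \<Longrightarrow> u \<in> B \<Longrightarrow> 1 \<le> h u"
    and h_step: "\<And>u v. u \<in> C \<Longrightarrow> v \<in> nbrs G u \<Longrightarrow> \<alpha> * h v \<le> h u"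
    and "0 \<le> \<alpha>"
    and "u \<in> C"
  shows "weight (tstate_at G \<alpha> \<beta> B t) u
    \<le> (if u \<in> B then h u else card (nbrs G u \<inter> spent (tstate_at G \<alpha> \<beta> B t)) * h u)"
  using \<open>u \<in> C\<close>
proof (induction t arbitrary: u)
  case 0
  then show ?case by (auto simp: tinit_def h_init)
next
  case (Suc t)
  define S where "S = tstate_at G \<alpha> \<beta> B t"
  let ?S' = "tstep G \<alpha> \<beta> S"
  note IH = Suc.IH[folded S_def]
  have [simp]: "finite (nbrs G u)" using fin Suc.prems by blast
  show ?case
  proof (cases "u \<in> unfilled G S")
    case False
    have "card (nbrs G u \<inter> spent S) \<le> card (nbrs G u \<inter> spent ?S')"
      by (rule card_mono) (auto simp: tstep_def)
    then have "card (nbrs G u \<inter> spent S) * h u \<le> card (nbrs G u \<inter> spent ?S') * h u"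
      using h_nonneg[OF Suc.prems] by (intro mult_right_mono) auto
    with IH[OF Suc.prems] False show ?thesis
      by (auto simp: S_def[symmetric] tstep_def new_weight_def split: if_splits)
  next
    case True
    have unf: "u \<notin> filled S" using True by (auto simp: unfilled_def)
    then have "u \<notin> B" "u \<notin> spent S"
      using initial_subset_filled[of B G \<alpha> \<beta> t] spent_subset_filled[of G \<alpha> \<beta> B t]
      by (auto simp: S_def)
    have transmitted: "\<alpha> * weight S v \<le> h u" if "v \<in> forcers G S u" for v
    proof -
      have uv: "u \<in> nbrs G v" using that by (auto simp: forcers_def)
      then have vC: "v \<in> C" and vu: "v \<in> nbrs G u" using closed[OF Suc.prems] by auto
      have "card (nbrs G v \<inter> spent S) \<le> card (nbrs G v - {u})"
        using \<open>u \<notin> spent S\<close> fin[OF vC] by (intro card_mono) auto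
      also have "\<dots> \<le> 1" using deg[OF vC] uv fin[OF vC] by simp
      finally have "card (nbrs G v \<inter> spent S) * h v \<le> 1 * h v"
        using h_nonneg[OF vC] by (intro mult_right_mono) auto
      with IH[OF vC] have "weight S v \<le> h v" by (auto split: if_splits)
      then have "\<alpha> * weight S v \<le> \<alpha> * h v" using \<open>0 \<le> \<alpha>\<close> by (rule mult_left_mono)
      with h_step[OF Suc.prems vu] show ?thesis by simp
    qed
    have sub: "forcers G S u \<subseteq> nbrs G u"
      using closed[OF Suc.prems] by (auto simp: forcers_def)
    then have [simp]: "finite (forcers G S u)" by (rule finite_subset) simp
    have "weight ?S' u = weight S u + (\<Sum>v\<in>forcers G S u. \<alpha> * weight S v)"
      using True by (simp add: tstep_def new_weight_def)
    also have "\<dots> \<le> card (nbrs G u \<inter> spent S) * h u + card (forcers G S u) * h u"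
      using IH[OF Suc.prems] \<open>u \<notin> B\<close> sum_bounded_above[of "forcers G S u" "\<lambda>v. \<alpha> * weight S v" "h u"] transmitted
      by auto
    \<comment> \<open>A forcer is unspent before the round and spent after it, so each transmission
      to \<open>u\<close> is counted once.\<close>
    also have "\<dots> = card ((nbrs G u \<inter> spent S) \<union> forcers G S u) * h u"
    proof (subst card_Un_disjoint)
      show "nbrs G u \<inter> spent S \<inter> forcers G S u = {}" by (auto simp: forcers_def)
    qed (simp_all add: algebra_simps)
    also have "\<dots> \<le> card (nbrs G u \<inter> spent ?S') * h u"
    proof -
      have "card ((nbrs G u \<inter> spent S) \<union> forcers G S u) \<le> card (nbrs G u \<inter> spent ?S')"
        using sub True by (intro card_mono) (auto simp: tstep_def)
      then show ?thesis using h_nonneg[OF Suc.prems] by (intro mult_right_mono) auto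
    qed
    finally show ?thesis using \<open>u \<notin> B\<close> by (simp add: S_def)
  qed
qed

text \<open>A vertex outside \<open>B\<close> needs weight \<open>\<beta>\<close> to be filled, but
  at most two neighbours transmit to it, contributing at most \<open>h u\<close> each. The first
  hypothesis makes \<open>C\<close> a region with no adjacency to the outside.\<close>

lemma never_filled:
  fixes h :: "'a \<Rightarrow> real"
  assumes closed: "\<And>u v. u \<in> C \<Longrightarrow> u \<in> nbrs G v \<Longrightarrow> v \<in> C \<and> v \<in> nbrs G u"
    and fin: "\<And>u. u \<in> C \<Longrightarrow> finite (nbrs G u)"
    and deg: "\<And>u. u \<in> C \<Longrightarrow> card (nbrs G u) \<le> 2"
    and h_nonneg: "\<And>u. u \<in> C \<Longrightarrow> 0 \<le> h u"
    and h_init: "\<And>u. u \<in> C \<Longrightarrow> u \<in> B \<Longrightarrow> 1 \<le> h u"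
    and h_step: "\<And>u v. u \<in> C \<Longrightarrow> v \<in> nbrs G u \<Longrightarrow> \<alpha> * h v \<le> h u"
    and "0 \<le> \<alpha>" "u \<in> C" "u \<notin> B" "2 * h u < \<beta>"
  shows "u \<notin> filled (tstate_at G \<alpha> \<beta> B t)"
proof
  let ?S = "tstate_at G \<alpha> \<beta> B t"
  assume "u \<in> filled ?S"
  then have "\<beta> \<le> weight ?S u" using filled_imp_weight_ge \<open>u \<notin> B\<close> by metis
  also have "\<dots> \<le> card (nbrs G u \<inter> spent ?S) * h u"
    using weight_le_card_spent[where h = h and C = C and G = G and B = B and \<alpha> = \<alpha> and u = u,
        OF closed fin deg h_nonneg h_init h_step \<open>0 \<le> \<alpha>\<close> \<open>u \<in> C\<close>] \<open>u \<notin> B\<close> by simp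
  also have "\<dots> \<le> 2 * h u"
  proof -
    have "card (nbrs G u \<inter> spent ?S) \<le> card (nbrs G u)"
      using fin \<open>u \<in> C\<close> by (intro card_mono) auto
    with deg[OF \<open>u \<in> C\<close>] have "card (nbrs G u \<inter> spent ?S) \<le> 2" by linarith
    then show ?thesis using h_nonneg[OF \<open>u \<in> C\<close>] by (intro mult_right_mono) auto
  qed
  finally show False using \<open>2 * h u < \<beta>\<close> by simp
qed

text \<open>While both pendants are unfilled, \<open>c\<close>, the only vertex that could force
  either, has two unfilled neighbours and forces nothing. So neither ever receives weight.\<close>

lemma two_pendants_never_filled:
  assumes a: "\<And>v. a \<in> nbrs G v \<Longrightarrow> v = c" and b: "\<And>v. b \<in> nbrs G v \<Longrightarrow> v = c"
    and adj: "a \<in> nbrs G c" "b \<in> nbrs G c" and verts: "a \<in> pverts G" "b \<in> pverts G"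
    and "a \<noteq> b" "a \<notin> B" "b \<notin> B" "0 < \<beta>"
  shows "a \<notin> filled (tstate_at G \<alpha> \<beta> B t)"
proof -
  let ?S = "tstate_at G \<alpha> \<beta> B"
  \<comment> \<open>The induction carries both vertices at once: each blocks \<open>c\<close> from
    forcing the other.\<close>
  have "a \<notin> filled (?S t) \<and> b \<notin> filled (?S t) \<and> weight (?S t) a = 0 \<and> weight (?S t) b = 0"
  proof (induction t)
    case 0
    then show ?case using \<open>a \<notin> B\<close> \<open>b \<notin> B\<close> by (simp add: tinit_def)
  next
    case (Suc t)
    then have "{a, b} \<subseteq> nbrs G c \<inter> unfilled G (?S t)"
      using adj verts by (auto simp: unfilled_def)
    then have not_single: "nbrs G c \<inter> unfilled G (?S t) \<noteq> {u}" for u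
      using \<open>a \<noteq> b\<close> by (metis insert_subset singletonD)
    have "forcers G (?S t) w = {}" if w: "\<And>v. w \<in> nbrs G v \<Longrightarrow> v = c" for w
    proof (rule equals0I)
      fix v assume "v \<in> forcers G (?S t) w"
      then have single: "nbrs G v \<inter> unfilled G (?S t) = {w}" by (simp add: forcers_def)
      then have "v = c" by (intro w) blast
      with single not_single show False by metis
    qed
    then have "forcers G (?S t) a = {}" "forcers G (?S t) b = {}"
      using a b by metis+
    then show ?case
      using Suc \<open>0 < \<beta>\<close> by (auto simp: tstep_def new_weight_def)
  qed
  then show ?thesis by simp
qed

section \<open>Adjacency in \<open>G_graph\<close> with and without the edge\<close>

lemma mem_PathV_Leaf_image_iff [simp]:
  "PathV i \<in> PathV ` A \<longleftrightarrow> i \<in> A"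
  "Leaf i \<in> Leaf ` A \<longleftrightarrow> i \<in> A"
  "PathV i \<notin> Leaf ` A"
  "Leaf i \<notin> PathV ` A"
  by auto

abbreviation G_cut :: "nat \<Rightarrow> nat \<Rightarrow> gvert pair_pre_digraph" where
  "G_cut l k \<equiv> delete_edge (G_graph l k) v_vertex x_vertex"

lemma pverts_G_cut: "pverts (G_cut l k) = Leaf ` {..<l} \<union> PathV ` {..k}"
  by (auto simp: delete_edge_def G_graph_def star_graph_def path_graph_def)

lemma mem_nbrs_G_graph_iff:
  "PathV i \<in> nbrs (G_graph l k) (PathV j) \<longleftrightarrow> i \<le> k \<and> j \<le> k \<and> (i = Suc j \<or> j = Suc i)"
  "PathV i \<in> nbrs (G_graph l k) (Leaf m) \<longleftrightarrow> i = 0 \<and> m < l"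
  "Leaf m \<in> nbrs (G_graph l k) (PathV i) \<longleftrightarrow> i = 0 \<and> m < l"
  "Leaf m \<notin> nbrs (G_graph l k) (Leaf n)"
  by (auto simp: mem_nbrs_iff G_graph_def star_graph_def path_graph_def)

lemma mem_nbrs_G_cut_iff:
  "u \<in> nbrs (G_cut l k) v \<longleftrightarrow>
    u \<in> nbrs (G_graph l k) v \<and> (v, u) \<notin> {(PathV 0, PathV 1), (PathV 1, PathV 0)}"
  by (auto simp: mem_nbrs_iff delete_edge_def v_vertex_def x_vertex_def)

section \<open>Lower bound without the edge\<close>

text \<open>With the edge deleted, \<open>PathV 1\<close> to \<open>PathV k\<close> form a closed
  region. Weight originating outside the window of radius \<open>n\<close> around \<open>c\<close>
  has decayed by \<open>\<alpha> ^ n\<close> on reaching \<open>PathV c\<close>, and two such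
  contributions stay below \<open>\<beta>\<close>.\<close>

lemma window_meets_zf_set:
  fixes \<alpha> \<beta> :: real
  assumes "0 < \<alpha>" "\<alpha> < 1" "0 < n" and n: "2 * \<alpha> ^ n < \<beta>" and c: "0 < c" "c \<le> k"
    and zf: "transmission_zf_set (G_cut l k) \<alpha> \<beta> B"
  shows "\<exists>j. 0 < j \<and> j < c + n \<and> c < j + n \<and> PathV j \<in> B"
proof (rule ccontr)
  assume none: "\<nexists>j. 0 < j \<and> j < c + n \<and> c < j + n \<and> PathV j \<in> B"
  \<comment> \<open>By truncated subtraction \<open>(j - c) + (c - j)\<close> is the distance from
    \<open>j\<close> to \<open>c\<close>. So \<open>e\<close> is \<open>n\<close> at
    \<open>PathV c\<close>, vanishes outside the window and changes by at most one along a path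
    edge.\<close>
  define e :: "gvert \<Rightarrow> nat" where
    "e u = (case u of PathV j \<Rightarrow> n - ((j - c) + (c - j)) | Leaf _ \<Rightarrow> 0)" for u
  let ?H = "G_cut l k" and ?C = "PathV ` {0<..k}" and ?h = "\<lambda>u. \<alpha> ^ e u"
  obtain t where t: "filled (tstate_at ?H \<alpha> \<beta> B t) = pverts ?H"
    using zf by (auto simp: transmission_zf_set_def)
  \<comment> \<open>For \<open>i = 1\<close> the right-hand side contains \<open>PathV 0\<close>, no
    longer a neighbour; the inclusion suffices for the degree bound and for comparing values of
    \<open>e\<close>.\<close>
  have nbrs_sub: "nbrs ?H (PathV i) \<subseteq> {PathV (i - 1), PathV (i + 1)}" if "0 < i" for i
  proof
    fix w assume "w \<in> nbrs ?H (PathV i)"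
    then show "w \<in> {PathV (i - 1), PathV (i + 1)}"
      using that by (cases w) (auto simp: mem_nbrs_G_cut_iff mem_nbrs_G_graph_iff)
  qed
  have "PathV c \<notin> filled (tstate_at ?H \<alpha> \<beta> B t)" if "PathV c \<notin> B"
  proof (rule never_filled[where C = ?C and h = ?h])
    show "v \<in> ?C \<and> v \<in> nbrs ?H u" if "u \<in> ?C" "u \<in> nbrs ?H v" for u v
      using that by (cases v) (auto simp: mem_nbrs_G_cut_iff mem_nbrs_G_graph_iff)
    show "finite (nbrs ?H u)" if "u \<in> ?C" for u
      using that finite_subset[OF nbrs_sub] by auto
    show "card (nbrs ?H u) \<le> 2" if uC: "u \<in> ?C" for u
    proof -
      obtain i where i: "0 < i" "u = PathV i" using uC by auto
      have "card (nbrs ?H u) \<le> card {PathV (i - 1), PathV (i + 1)}"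
        unfolding i using nbrs_sub[OF i(1)] by (intro card_mono) auto
      then show ?thesis by simp
    qed
    show "1 \<le> ?h u" if uC: "u \<in> ?C" and uB: "u \<in> B" for u
    proof -
      obtain j where j: "0 < j" "u = PathV j" using uC by auto
      then have "\<not> (j < c + n \<and> c < j + n)" using none uB by auto
      then have "e u = 0" by (auto simp: e_def j)
      then show ?thesis by simp
    qed
    show "\<alpha> * ?h v \<le> ?h u" if uC: "u \<in> ?C" and vu: "v \<in> nbrs ?H u" for u v
    proof -
      obtain i where i: "0 < i" "u = PathV i" using uC by auto
      then have "v = PathV (i - 1) \<or> v = PathV (i + 1)" using nbrs_sub[of i] vu by auto
      then have "e u \<le> Suc (e v)" using i by (auto simp: e_def)
      then have "\<alpha> ^ Suc (e v) \<le> \<alpha> ^ e u"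
        using \<open>0 < \<alpha>\<close> \<open>\<alpha> < 1\<close> by (intro power_decreasing) auto
      then show ?thesis by simp
    qed
  qed (use assms that in \<open>auto simp: e_def\<close>)
  moreover have "PathV c \<in> pverts ?H" using c by (auto simp: pverts_G_cut)
  ultimately have "PathV c \<in> B" using t by blast
  then show False using none c \<open>0 < n\<close> by (metis less_add_same_cancel1)
qed

text \<open>Two disjoint parts of \<open>B\<close> are counted: all leaves but at most one, and one
  path vertex from each of \<open>q\<close> disjoint blocks.\<close>

lemma card_zf_set_G_cut_ge:
  fixes \<alpha> \<beta> :: real
  assumes "0 < \<alpha>" "\<alpha> < 1" "0 < \<beta>" "0 < n" and n: "2 * \<alpha> ^ n < \<beta>"
    and k: "k = 2 * n * q"
    and zf: "transmission_zf_set (G_cut l k) \<alpha> \<beta> B"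
  shows "l + q \<le> Suc (card B)"
proof -
  let ?H = "G_cut l k"
  interpret pair_graph ?H by (intro pair_graph_delete_edge pair_graph_G_graph)
  obtain t where t: "filled (tstate_at ?H \<alpha> \<beta> B t) = pverts ?H" and B: "B \<subseteq> pverts ?H"
    using zf by (auto simp: transmission_zf_set_def)
  have "finite B" using B pair_finite_verts finite_subset by blast
  \<comment> \<open>Block \<open>i\<close> is the window of radius \<open>n\<close> centred at
    \<open>2 * n * i + n\<close>; excluding both ends keeps the blocks disjoint and avoids
    \<open>PathV 0\<close>.\<close>
  have "\<forall>i<q. \<exists>j. 2 * n * i < j \<and> j < 2 * n * Suc i \<and> PathV j \<in> B"
  proof (intro allI impI)
    fix i assume "i < q"
    then have "2 * n * Suc i \<le> k" unfolding k by (intro mult_le_mono) auto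
    then have "2 * n * i + n \<le> k" by simp
    then obtain j where "j < 2 * n * i + n + n" "2 * n * i + n < j + n" "PathV j \<in> B"
      using window_meets_zf_set[OF assms(1,2,4) n _ _ zf, of "2 * n * i + n"] \<open>0 < n\<close> by auto
    then show "\<exists>j. 2 * n * i < j \<and> j < 2 * n * Suc i \<and> PathV j \<in> B"
      by (intro exI[of _ j]) simp
  qed
  then obtain g where g: "\<And>i. i < q \<Longrightarrow> 2 * n * i < g i \<and> g i < 2 * n * Suc i \<and> PathV (g i) \<in> B"
    by metis
  \<comment> \<open>Division recovers the block from its representative, which gives
    injectivity.\<close>
  have "i = g i div (2 * n)" if "i < q" for i
    using g[OF that] by (intro div_nat_eqI[symmetric]) (auto simp: mult.commute)
  then have "inj_on (\<lambda>i. PathV (g i)) {..<q}"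
    by (intro inj_onI) (metis gvert.inject(1) lessThan_iff)
  then have path: "card ((\<lambda>i. PathV (g i)) ` {..<q}) = q" by (simp add: card_image)
  have leaf_unique: "a = b" if "a \<in> Leaf ` {..<l} - B" "b \<in> Leaf ` {..<l} - B" for a b
  proof (rule ccontr)
    assume "a \<noteq> b"
    have "v = PathV 0" if "w \<in> Leaf ` {..<l}" "w \<in> nbrs ?H v" for v w
      using that by (cases v) (auto simp: mem_nbrs_G_cut_iff mem_nbrs_G_graph_iff)
    then have "a \<notin> filled (tstate_at ?H \<alpha> \<beta> B t)"
      using that \<open>a \<noteq> b\<close> \<open>0 < \<beta>\<close>
      by (intro two_pendants_never_filled[where c = "PathV 0" and b = b])
        (auto simp: mem_nbrs_G_cut_iff mem_nbrs_G_graph_iff pverts_G_cut)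
    with t that show False by (auto simp: pverts_G_cut)
  qed
  have "card (Leaf ` {..<l} - B) \<le> 1"
    using leaf_unique by (simp add: card_le_Suc0_iff_eq)
  moreover have "card (Leaf ` {..<l}) = card (Leaf ` {..<l} - B) + card (Leaf ` {..<l} \<inter> B)"
    by (subst card_Un_disjoint[symmetric]) (auto intro: arg_cong[where f = card])
  moreover have "card (Leaf ` {..<l}) = l"
    by (simp add: card_image inj_on_def)
  ultimately have leaves: "l \<le> Suc (card (Leaf ` {..<l} \<inter> B))" by linarith
  have "card (Leaf ` {..<l} \<inter> B) + q = card ((Leaf ` {..<l} \<inter> B) \<union> (\<lambda>i. PathV (g i)) ` {..<q})"
    using path by (subst card_Un_disjoint) auto
  also have "\<dots> \<le> card B" using g \<open>finite B\<close> by (intro card_mono) auto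
  finally show ?thesis using leaves by linarith
qed

section \<open>Upper bound with the edge\<close>

text \<open>Each round fills the next path vertex, with weight \<open>\<alpha>\<close> times that of
  its predecessor. The smallest weight, \<open>l * \<alpha> ^ Suc k\<close>, occurs at the far end
  \<open>PathV k\<close>.\<close>

lemma leaves_zf_set_G_graph:
  fixes \<alpha> \<beta> :: real
  assumes "0 < \<alpha>" "\<alpha> < 1" "0 < \<beta>" and l: "\<beta> \<le> l * \<alpha> ^ Suc k"
  shows "transmission_zf_set (G_graph l k) \<alpha> \<beta> (Leaf ` {..<l})"
proof -
  let ?G = "G_graph l k" and ?L = "Leaf ` {..<l}"
  let ?S = "tstate_at ?G \<alpha> \<beta> ?L"
  have verts: "pverts ?G = ?L \<union> PathV ` {..k}"
    by (auto simp: G_graph_def star_graph_def path_graph_def)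
  have big: "\<beta> \<le> l * \<alpha> ^ Suc t" if "t \<le> k" for t
  proof -
    have "l * \<alpha> ^ Suc k \<le> l * \<alpha> ^ Suc t"
      using assms that by (intro mult_left_mono power_decreasing) auto
    with l show ?thesis by linarith
  qed
  \<comment> \<open>The bound on \<open>spent\<close> leaves out the newest vertex
    \<open>PathV (t - 1)\<close>, which has to transmit next. At \<open>t = 0\<close> it is the
    leaves that must still be unspent, hence the case distinction.\<close>
  have inv: "filled (?S t) = ?L \<union> PathV ` {..<t} \<and>
      spent (?S t) \<subseteq> (if t = 0 then {} else ?L \<union> PathV ` {..<t - 1}) \<and>
      (\<forall>m<l. weight (?S t) (Leaf m) = 1) \<and>
      (\<forall>i. weight (?S t) (PathV i) = (if i < t then l * \<alpha> ^ Suc i else 0))"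
    if "t \<le> Suc k" for t
    using that
  proof (induction t)
    case 0
    then show ?case by (auto simp: tinit_def)
  next
    case (Suc t)
    define S where "S = ?S t"
    have S_Suc: "?S (Suc t) = tstep ?G \<alpha> \<beta> S" by (simp add: S_def)
    from Suc have IH: "filled S = ?L \<union> PathV ` {..<t}"
        "spent S \<subseteq> (if t = 0 then {} else ?L \<union> PathV ` {..<t - 1})"
        "\<And>m. m < l \<Longrightarrow> weight S (Leaf m) = 1"
        "\<And>i. weight S (PathV i) = (if i < t then l * \<alpha> ^ Suc i else 0)"
      and "t \<le> k" unfolding S_def by auto
    have unf: "unfilled ?G S = PathV ` {t..k}"
      using IH(1) by (auto simp: unfilled_def verts)
    have iff: "w \<in> forcers ?G S (PathV t) \<longleftrightarrow> w \<in> ?L \<union> PathV ` {..<t} \<and>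
        nbrs ?G w \<inter> PathV ` {t..k} = {PathV t} \<and> w \<notin> spent S" for w
      by (simp add: forcers_def unf IH(1))
    \<comment> \<open>All leaves transmit to \<open>PathV 0\<close> in the first round. Later only
      the newest path vertex does, since leaves and earlier path vertices are not adjacent to
      \<open>PathV t\<close>.\<close>
    have forcers_t: "forcers ?G S (PathV t) = (if t = 0 then ?L else {PathV (t - 1)})"
    proof (rule set_eqI)
      fix w
      show "w \<in> forcers ?G S (PathV t) \<longleftrightarrow> w \<in> (if t = 0 then ?L else {PathV (t - 1)})"
      proof (cases w)
        case (PathV i)
        consider "Suc i = t" | "Suc i < t" | "t \<le> i" by linarith
        then show ?thesis
        proof cases
          case 1
          then have "nbrs ?G (PathV i) \<inter> PathV ` {t..k} = {PathV t}"
            using \<open>t \<le> k\<close> by (auto simp: mem_nbrs_G_graph_iff)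
          moreover have "PathV i \<notin> spent S" using IH(2) 1 by (auto split: if_splits)
          moreover have "t \<noteq> 0" "i < t" "i = t - 1" using 1 by auto
          ultimately show ?thesis unfolding iff PathV by simp
        next
          case 2
          then have "PathV t \<notin> nbrs ?G (PathV i)" by (simp add: mem_nbrs_G_graph_iff)
          then have "nbrs ?G (PathV i) \<inter> PathV ` {t..k} \<noteq> {PathV t}" by (metis IntD1 singletonI)
          moreover have "i \<noteq> t - 1" "t \<noteq> 0" using 2 by auto
          ultimately show ?thesis unfolding iff PathV by simp
        next
          case 3
          then have "\<not> i < t" "t \<noteq> 0 \<Longrightarrow> i \<noteq> t - 1" by auto
          then show ?thesis unfolding iff PathV by simp
        qed
      next
        case (Leaf m)
        have "nbrs ?G (Leaf m) = {PathV 0}" if "m < l"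
        proof (rule set_eqI)
          fix y show "y \<in> nbrs ?G (Leaf m) \<longleftrightarrow> y \<in> {PathV 0}"
            using that by (cases y) (simp_all add: mem_nbrs_G_graph_iff)
        qed
        then show ?thesis
          unfolding iff Leaf using IH(2) by (cases "m < l"; cases "t = 0") simp_all
      qed
    qed
    have forcers_gt: "forcers ?G S (PathV i) = {}" if "t < i" for i
    proof (rule equals0I)
      fix w assume w: "w \<in> forcers ?G S (PathV i)"
      then have "nbrs ?G w \<inter> unfilled ?G S = {PathV i}" by (simp add: forcers_def)
      then have "PathV i \<in> nbrs ?G w" by blast
      moreover from w have "w \<in> ?L \<union> PathV ` {..<t}" by (simp add: forcers_def IH(1))
      ultimately show False using \<open>t < i\<close> by (auto simp: mem_nbrs_G_graph_iff)
    qed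
    have w_path: "new_weight ?G \<alpha> S (PathV i) = (if i < Suc t then l * \<alpha> ^ Suc i else 0)" for i
    proof -
      consider "i < t" | "i = t" | "t < i" by linarith
      then show ?thesis
      proof cases
        case 2
        show ?thesis
        proof (cases "t = 0")
          case True
          have "(\<Sum>v\<in>?L. \<alpha> * weight S v) = (\<Sum>v\<in>?L. \<alpha>)"
            using IH(3) by (intro sum.cong) auto
          also have "\<dots> = l * \<alpha>" by (simp add: card_image inj_on_def)
          finally show ?thesis
            using 2 True forcers_t \<open>t \<le> k\<close> IH(4) by (simp add: new_weight_def unf)
        next
          case False
          then obtain s where "t = Suc s" by (cases t) auto
          then show ?thesis
            using 2 forcers_t \<open>t \<le> k\<close> IH(4) by (simp add: new_weight_def unf)
        qed
      qed (use forcers_gt IH(4) in \<open>auto simp: new_weight_def unf\<close>)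
    qed
    have w_leaf: "new_weight ?G \<alpha> S (Leaf m) = 1" if "m < l" for m
      using IH(3)[OF that] by (auto simp: new_weight_def unf)
    have "{u \<in> unfilled ?G S. \<beta> \<le> new_weight ?G \<alpha> S u} = {PathV t}"
      using big[OF \<open>t \<le> k\<close>] \<open>t \<le> k\<close> \<open>0 < \<beta>\<close> unfolding unf
      by (auto simp: w_path simp del: power_Suc split: if_splits)
    then have "filled (?S (Suc t)) = ?L \<union> PathV ` {..<Suc t}"
      unfolding S_Suc by (auto simp: tstep_def IH(1) lessThan_Suc)
    \<comment> \<open>Only vertices filled before a round transmit in it, so \<open>PathV t\<close>
      is still unspent.\<close>
    moreover have "spent (?S (Suc t)) \<subseteq> ?L \<union> PathV ` {..<t}"
      using IH(1) spent_subset_filled[of ?G \<alpha> \<beta> ?L t, folded S_def]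
      unfolding S_Suc by (auto simp: tstep_def forcers_def)
    moreover have "weight (?S (Suc t)) = new_weight ?G \<alpha> S"
      unfolding S_Suc by (simp add: tstep_def)
    ultimately show ?case using w_path w_leaf by (simp del: tstate_at.simps)
  qed
  have "filled (?S (Suc k)) = pverts ?G"
    using inv[of "Suc k"] by (simp add: verts lessThan_Suc_atMost)
  then show ?thesis unfolding transmission_zf_set_def verts by blast
qed

theorem theorem5p2p1:
  fixes \<alpha> \<beta> :: real and p :: nat
  assumes "0 < \<alpha>" "\<alpha> < 1" "0 < \<beta>" "\<beta> < 1" and "p > 0"
  shows "\<exists>k l :: nat. k > 0 \<and> l > 0 \<and>
           int (transmission_zf_number (delete_edge (G_graph l k) v_vertex x_vertex) \<alpha> \<beta>)
             - int (transmission_zf_number (G_graph l k) \<alpha> \<beta>) \<ge> int p"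
proof -
  obtain n where n: "2 * \<alpha> ^ n < \<beta>"
    using real_arch_pow_inv[of "\<beta> / 2" \<alpha>] assms by (auto simp: field_simps)
  \<comment> \<open>The value \<open>n = 0\<close> would give \<open>2 < \<beta>\<close>, against
    \<open>\<beta> < 1\<close>.\<close>
  with assms have "0 < n" by (cases n) auto
  \<comment> \<open>The extra block beyond \<open>p\<close> makes up for the one leaf that may be
    missing from \<open>B\<close>.\<close>
  define k where "k = 2 * n * Suc p"
  \<comment> \<open>With \<open>k\<close> fixed, \<open>l\<close> is taken large enough to outweigh
    the decay along the whole path.\<close>
  obtain l :: nat where "\<beta> < l * \<alpha> ^ Suc k"
    using reals_Archimedean3[of "\<alpha> ^ Suc k"] assms by auto
  with assms have "0 < l" by (cases l) auto
  let ?H = "G_cut l k" and ?G = "G_graph l k"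
  have "l + p \<le> card B" if "transmission_zf_set ?H \<alpha> \<beta> B" for B
    using card_zf_set_G_cut_ge[OF assms(1-3) \<open>0 < n\<close> n k_def that] by simp
  then have "l + p \<le> transmission_zf_number ?H \<alpha> \<beta>"
    unfolding transmission_zf_number_def
    using finite_transmission_zf_sets[OF pair_graph_delete_edge[OF pair_graph_G_graph]]
      transmission_zf_set_pverts
    by (subst Min_ge_iff) blast+
  moreover have "transmission_zf_number ?G \<alpha> \<beta> \<le> card (Leaf ` {..<l})"
    unfolding transmission_zf_number_def
    using finite_transmission_zf_sets[OF pair_graph_G_graph] \<open>\<beta> < l * \<alpha> ^ Suc k\<close>
      leaves_zf_set_G_graph[OF assms(1-3)]
    by (intro Min_le) auto
  moreover have "card (Leaf ` {..<l}) = l"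
    by (simp add: card_image inj_on_def)
  ultimately have "int (transmission_zf_number ?H \<alpha> \<beta>) - int (transmission_zf_number ?G \<alpha> \<beta>) \<ge> int p"
    by linarith
  moreover have "0 < k" using \<open>0 < n\<close> by (simp add: k_def)
  ultimately show ?thesis using \<open>0 < l\<close> by blast
qed

end
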